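(* Let $A$ be a finite-dimensional anti-commutative algebra over a field $F$. Then $A$ is a CL-algebra if and only if $A$ is a CB-algebra.
   Context: An algebra over $F$ is a vector space with a bilinear product (not assumed associative), written by juxtaposition. It is anti-commutative if $x^2=0$ for all $x\in A$. For $x\in A$ the centralizer of $x$ is $C_A(x)=\{y\in A\mid xy=0\}$. An ideal of $A$ is a subspace $I$ with $IA\subseteq I$ (automatically two-sided by anti-commutativity). $A$ is a CL-algebra if $C_A(x)$ is an ideal of $A$ for every $x\in A$. $A$ is a CB-algebra if, whenever $x,y\in A$ satisfy $xy=0$, then $(xz)y=0$ for all $z\in A$. *)

theory Defs
  imports Complex_Main
begin

text \<open>The vector space underlying an algebra is a whole type, with scalar multiplication
  \<open>scale\<close>; the product \<open>mult\<close> is not assumed to be associative or unital.\<close>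

locale nonassoc_algebra = vector_space scale
  for scale :: "'f::field \<Rightarrow> 'a::ab_group_add \<Rightarrow> 'a" +
  fixes mult :: "'a \<Rightarrow> 'a \<Rightarrow> 'a"
  assumes linear_mult_left: "\<And>y. Vector_Spaces.linear scale scale (\<lambda>x. mult x y)"
    and linear_mult_right: "\<And>x. Vector_Spaces.linear scale scale (\<lambda>y. mult x y)"

locale anticommutative_algebra = nonassoc_algebra scale mult
  for scale :: "'f::field \<Rightarrow> 'a::ab_group_add \<Rightarrow> 'a"
    and mult :: "'a \<Rightarrow> 'a \<Rightarrow> 'a" +
  assumes mult_self: "mult x x = 0"

definition centralizer :: "('a::ab_group_add \<Rightarrow> 'a \<Rightarrow> 'a) \<Rightarrow> 'a \<Rightarrow> 'a set" where
  "centralizer mult x = {y. mult x y = 0}"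

text \<open>Only absorption on the right is required: in an anti-commutative algebra such an
  ideal is automatically two-sided.\<close>

definition algebra_ideal ::
  "('f::field \<Rightarrow> 'a::ab_group_add \<Rightarrow> 'a) \<Rightarrow> ('a \<Rightarrow> 'a \<Rightarrow> 'a) \<Rightarrow> 'a set \<Rightarrow> bool" where
  "algebra_ideal scale mult I \<longleftrightarrow>
     module.subspace scale I \<and> (\<forall>x\<in>I. \<forall>a. mult x a \<in> I)"

definition CL_algebra ::
  "('f::field \<Rightarrow> 'a::ab_group_add \<Rightarrow> 'a) \<Rightarrow> ('a \<Rightarrow> 'a \<Rightarrow> 'a) \<Rightarrow> bool" where
  "CL_algebra scale mult \<longleftrightarrow> (\<forall>x. algebra_ideal scale mult (centralizer mult x))"

definition CB_algebra :: "('a::ab_group_add \<Rightarrow> 'a \<Rightarrow> 'a) \<Rightarrow> bool" where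
  "CB_algebra mult \<longleftrightarrow> (\<forall>x y. mult x y = 0 \<longrightarrow> (\<forall>z. mult (mult x z) y = 0))"

end

theory Submission
  imports Defs
begin

text \<open>Each centralizer is the kernel of a linear map, hence a subspace, so CL only demands
  absorption: \<open>xy = 0\<close> implies \<open>x(yz) = 0\<close>. Exchanging \<open>x\<close>
  and \<open>y\<close> in CB gives: \<open>yx = 0\<close> implies \<open>(yz)x = 0\<close>. By
  anti-commutativity a product vanishes in one order iff it vanishes in the other
  (\<open>mult_eq_0_commute\<close>), so the two conditions coincide.\<close>

context anticommutative_algebra
begin

text \<open>Polarization: expand the square of \<open>x + y\<close>; all three squares
  vanish.\<close>

lemma mult_anticomm: "mult x y = - mult y x"
proof -
  interpret L: Vector_Spaces.linear scale scale "\<lambda>u. mult u v" for v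
    by (rule linear_mult_left)
  interpret R: Vector_Spaces.linear scale scale "\<lambda>v. mult u v" for u
    by (rule linear_mult_right)
  have "mult x y + mult y x = mult (x + y) (x + y)"
    unfolding L.add R.add by (simp add: mult_self)
  then show ?thesis
    by (simp add: mult_self eq_neg_iff_add_eq_0)
qed

lemma mult_eq_0_commute: "mult x y = 0 \<longleftrightarrow> mult y x = 0"
  using mult_anticomm[of x y] by simp

lemma subspace_centralizer: "subspace (centralizer mult x)"
proof -
  interpret R: Vector_Spaces.linear scale scale "\<lambda>y. mult x y"
    by (rule linear_mult_right)
  show ?thesis
    unfolding centralizer_def by (rule R.subspace_kernel)
qed

lemma CL_algebra_iff_CB_algebra: "CL_algebra scale mult \<longleftrightarrow> CB_algebra mult"
proof -
  have "CL_algebra scale mult \<longleftrightarrow>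
      (\<forall>x y. mult x y = 0 \<longrightarrow> (\<forall>z. mult x (mult y z) = 0))"
    \<comment> \<open>\<open>centralizer\<close> stays folded in the first call so that
      \<open>subspace_centralizer\<close> can discharge the subspace part.\<close>
    by (simp add: CL_algebra_def algebra_ideal_def subspace_centralizer)
      (simp add: centralizer_def)
  \<comment> \<open>The roles of \<open>x\<close> and \<open>y\<close> are swapped here, and both
    the premise and the conclusion are commuted.\<close>
  also have "\<dots> \<longleftrightarrow> CB_algebra mult"
    unfolding CB_algebra_def using mult_eq_0_commute by blast
  finally show ?thesis .
qed

end

theorem theorem3p9:
  fixes scale :: "'f::field \<Rightarrow> 'a::ab_group_add \<Rightarrow> 'a"
    and mult :: "'a \<Rightarrow> 'a \<Rightarrow> 'a"
  assumes "anticommutative_algebra scale mult"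
    and "\<exists>B. finite_dimensional_vector_space scale B"
  shows "CL_algebra scale mult \<longleftrightarrow> CB_algebra mult"
  using assms(1) by (rule anticommutative_algebra.CL_algebra_iff_CB_algebra)

end
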